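(* Let $D$ be a diagram of a hyperbolic link $L=L_1\cup\dots\cup L_n$ with $n$ components, let $\boldsymbol 1=(1,\dots,1)\in\mathbb Z^n$, and let $\Phi_D(a_1,\dots,a_n,w_1,\dots,w_\nu)$ be the potential function of $D$. Then the point $(\boldsymbol 1,\sigma_1(\boldsymbol 1),\dots,\sigma_\nu(\boldsymbol 1))$ is a saddle point of the function $\Phi_D(a_1,\dots,a_n,w_1,\dots,w_\nu)$ of all the variables, that is, it is a solution of $$\exp\left(w_i\frac{\partial\Phi_D}{\partial w_i}\right)=1\quad(i=1,\dots,\nu),\qquad \exp\left(\frac{1}{\pi\sqrt{-1}}\frac{\partial\Phi_D}{\partial a_j}\right)=1\quad(j=1,\dots,n),$$ and it gives a complete hyperbolic structure to the link complement.
   Context: **Diagram.** $L=L_1\cup\dots\cup L_n$ is an oriented link in $S^3$ presented as the closure of a braid, and $D$ is its oriented diagram. To each component $L_i$ a parameter $a_i$ is assigned (in the source, $a_i=\lim_{N\to\infty} a_i(N)/N$ where $a_i(N)$ is the color of $L_i$ in the colored Jones polynomial at $t=e^{2\pi\sqrt{-1}/N}$). To each region of $D$ a nonzero complex variable $w_1,\dots,w_\nu$ is assigned. Write $e_a=e^{\pi\sqrt{-1}\,a}$. At a crossing $c$, draw both strands oriented upwards; let $j_1,j_2,j_3,j_4$ be the indices of the regions to the left of, below (between the two incoming strands), to the right of, and above (between the two outgoing strands) the crossing; let $a$ be the parameter of the component of the over-strand and $b$ that of the under-strand. $\mathrm{Li}_2(z)=-\int_0^z\frac{\log(1-x)}{x}dx$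 is the dilogarithm. **Potential function.** For a positive crossing $c$ between different components, $$\Phi_c^+=\pi\sqrt{-1}\,\tfrac{a+b}{2}\log\tfrac{w_{j_1}w_{j_3}}{w_{j_2}w_{j_4}}-\log\tfrac{w_{j_2}}{w_{j_1}}\log\tfrac{w_{j_3}}{w_{j_2}}-\mathrm{Li}_2\!\left(e_a\tfrac{w_{j_4}}{w_{j_3}}\right)-\mathrm{Li}_2\!\left(e_b\tfrac{w_{j_4}}{w_{j_1}}\right)+\mathrm{Li}_2\!\left(\tfrac{w_{j_2}w_{j_4}}{w_{j_1}w_{j_3}}\right)+\mathrm{Li}_2\!\left(e_a\tfrac{w_{j_1}}{w_{j_2}}\right)+\mathrm{Li}_2\!\left(e_b\tfrac{w_{j_3}}{w_{j_2}}\right)-\tfrac{\pi^2}{6},$$ and for a negative crossing between different components, $$\Phi_c^-=-\pi\sqrt{-1}\,\tfrac{a+b}{2}\log\tfrac{w_{j_1}w_{j_3}}{w_{j_2}w_{j_4}}+\log\tfrac{w_{j_3}}{w_{j_4}}\log\tfrac{w_{j_4}}{w_{j_1}}-\mathrm{Li}_2\!\left(e_a\tfrac{w_{j_1}}{w_{j_4}}\right)-\mathrm{Li}_2\!\left(e_b\tfrac{w_{j_3}}{w_{j_4}}\right)-\mathrm{Li}_2\!\left(\tfrac{w_{j_2}w_{j_4}}{w_{j_1}w_{j_3}}\right)+\mathrm{Li}_2\!\left(e_a\tfrac{w_{j_2}}{w_{j_3}}\right)+\mathrm{Li}_2\!\left(e_b\tfrac{w_{j_2}}{w_{j_1}}\right)+\tfrac{\pi^2}{6}.$$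 If both strands at $c$ belong to the same component (so $b=a$), $\Phi_c^{\pm}$ is given by the same formula with $b=a$, plus the extra term $\pm(\pi\sqrt{-1}\,a)^2$. Then $\Phi_D(\boldsymbol a,w_1,\dots,w_\nu)=\sum_c\Phi_c^{\mathrm{sgn}(c)}$, the sum over all crossings of $D$, where $\boldsymbol a=(a_1,\dots,a_n)$. $\Phi_D$ is a multivalued analytic function. **Saddle points and hyperbolic structures.** For fixed $\boldsymbol a$, a saddle point of $\Phi_D(\boldsymbol a,-)$ is a solution of $\exp\left(w_i\,\partial\Phi_D/\partial w_i\right)=1$, $i=1,\dots,\nu$. These equations are the gluing equations of Thurston's octahedral triangulation of the link complement: at each crossing there is an ideal octahedron with a vertex $E$ on the over-strand, a vertex $F$ on the under-strand and equatorial vertices $A,B,C,D'$, whose equatorial edges $D'A,AB,BC,CD'$ pass through regions $j_1,j_2,j_3,j_4$ respectively ($A,C$ lie below the incoming and outgoing over-strand and are pulled to a point $-\infty$; $B,D'$ lie above the incoming and outgoing under-strand and are pulled to a point $+\infty$). It is divided into five ideal tetrahedra $EABD'$, $EBCD'$, $ABCD'$, $FACD'$, $FABC$. With $z'=1/(1-z)$, $z''=1-1/z$, the moduli are as follows. Positive crossing: in this order $u_1=e_a\frac{w_{j_1}}{w_{j_2}}$, $u_2=e_a^{-1}\frac{w_{j_3}}{w_{j_4}}$, $u_3=\frac{w_{j_2}w_{j_4}}{w_{j_1}w_{j_3}}$, $u_4=e_b^{-1}\frac{w_{j_1}}{w_{j_4}}$, $u_5=e_b\frac{w_{j_3}}{w_{j_2}}$,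 and the products of edge parameters at the edges through $j_1,j_2,j_3,j_4$ are $u_1'u_4'u_3''$, $u_1''u_5''u_3'$, $u_2'u_5'u_3''$, $u_2''u_4''u_3'$. Negative crossing: the five tetrahedra have moduli $v_1=e_a^{-1}\frac{w_{j_4}}{w_{j_1}}$, $v_2=e_a\frac{w_{j_2}}{w_{j_3}}$, $v_3=\frac{w_{j_1}w_{j_3}}{w_{j_2}w_{j_4}}$, $v_4=e_b\frac{w_{j_2}}{w_{j_1}}$, $v_5=e_b^{-1}\frac{w_{j_4}}{w_{j_3}}$ ($v_3$ is the central tetrahedron; $v_1,v_2$ have their apex on the over-strand and $v_4,v_5$ on the under-strand; each non-central tetrahedron contains the two equatorial edges whose regions occur in its modulus), and the products at the edges through $j_1,j_2,j_3,j_4$ are $v_1''v_4''v_3'$, $v_2'v_4'v_3''$, $v_2''v_5''v_3'$, $v_1'v_5'v_3''$. **Standing assumptions.** $(\sigma_1(\boldsymbol a),\dots,\sigma_\nu(\boldsymbol a))$ denotes, for $\boldsymbol a$ with entries in $[1-\varepsilon,1]$ ($\varepsilon>0$ small), a saddle point of $\Phi_D(\boldsymbol a,-)$ giving the link complement a (generally non-complete) hyperbolic structure via the five ideal tetrahedra at each crossing of $D$, with moduli $u_1,\dots,u_5$ at a positive crossing and $v_1,\dots,v_5$ at a negative crossing evaluated at $w_j=\sigma_j(\boldsymbol a)$; it is supposed that for $\boldsymbol a=\boldsymbol 1$ it gives $S^3\setminus L$ the hyperbolic structure with the finite volume $\mathrm{Vol}(S^3\setminus L)$. *)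

theory Defs
  imports "HOL-Analysis.Analysis"
begin

text \<open>
  A braid on \<open>m\<close> strands, drawn upwards with positions \<open>0, \<dots>, m - 1\<close> from left to right, is a
  word of crossings listed from bottom to top.  The letter \<open>(k, s)\<close> exchanges the positions
  \<open>k - 1\<close> and \<open>k\<close>.  It is positive iff \<open>s\<close> holds, and then the over-strand runs from the bottom
  left to the top right; in a negative crossing it runs from the bottom right to the top left.
\<close>

type_synonym braid = "(nat \<times> bool) list"

definition braid_word :: "nat \<Rightarrow> braid \<Rightarrow> bool" where
  "braid_word m \<beta> \<longleftrightarrow> (\<forall>(k, s) \<in> set \<beta>. 1 \<le> k \<and> k < m)"

definition col :: "braid \<Rightarrow> nat \<Rightarrow> nat" where
  "col \<beta> t = fst (\<beta> ! t)"

definition positive :: "braid \<Rightarrow> nat \<Rightarrow> bool" where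
  "positive \<beta> t = snd (\<beta> ! t)"

definition over_in :: "braid \<Rightarrow> nat \<Rightarrow> nat" where
  "over_in \<beta> t = (if positive \<beta> t then col \<beta> t - 1 else col \<beta> t)"

definition under_in :: "braid \<Rightarrow> nat \<Rightarrow> nat" where
  "under_in \<beta> t = (if positive \<beta> t then col \<beta> t else col \<beta> t - 1)"

definition step :: "braid \<Rightarrow> nat \<Rightarrow> nat \<Rightarrow> nat" where
  "step \<beta> t i = (if i = col \<beta> t - 1 then col \<beta> t else if i = col \<beta> t then col \<beta> t - 1 else i)"

primrec track :: "braid \<Rightarrow> nat \<Rightarrow> nat \<Rightarrow> nat" where
  "track \<beta> 0 i = i"
| "track \<beta> (Suc t) i = step \<beta> t (track \<beta> t i)"

text \<open>
  The arc \<open>(t, i)\<close> is the piece of the diagram in position \<open>i\<close> just below crossing \<open>t\<close>.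
  A component of the closure is named by the least position that it occupies at level \<open>0\<close>.
\<close>

definition component :: "braid \<Rightarrow> nat \<Rightarrow> nat \<Rightarrow> nat" where
  "component \<beta> t i = (LEAST c. \<exists>n. track \<beta> t ((track \<beta> (length \<beta>) ^^ n) c) = i)"

definition link_components :: "nat \<Rightarrow> braid \<Rightarrow> nat set" where
  "link_components m \<beta> = component \<beta> 0 ` {..<m}"

text \<open>
  Column \<open>k\<close> is the strip between the positions \<open>k - 1\<close> and \<open>k\<close>; the crossings of column \<open>k\<close> cut
  it into the regions of the diagram.  The region of column \<open>k\<close> at level \<open>t\<close> is named by \<open>k\<close> and
  the crossing (plus one) at its lower end, which is found by going down, cyclically through the
  closure; the second entry is \<open>0\<close> for a column without crossings.
\<close>

type_synonym region = "nat \<times> nat"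

definition region_at :: "braid \<Rightarrow> nat \<Rightarrow> nat \<Rightarrow> region" where
  "region_at \<beta> k t =
     (let S = {p. p < t \<and> p < length \<beta> \<and> col \<beta> p = k};
          S' = {p. p < length \<beta> \<and> col \<beta> p = k}
      in (k, if S \<noteq> {} then Suc (Max S) else if S' \<noteq> {} then Suc (Max S') else 0))"

definition regions :: "nat \<Rightarrow> braid \<Rightarrow> region set" where
  "regions m \<beta> = {region_at \<beta> k t | k t. k \<le> m \<and> t \<le> length \<beta>}"

definition left_region :: "braid \<Rightarrow> nat \<Rightarrow> region" where
  "left_region \<beta> t = region_at \<beta> (col \<beta> t - 1) t"

definition lower_region :: "braid \<Rightarrow> nat \<Rightarrow> region" where
  "lower_region \<beta> t = region_at \<beta> (col \<beta> t) t"

definition right_region :: "braid \<Rightarrow> nat \<Rightarrow> region" where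
  "right_region \<beta> t = region_at \<beta> (col \<beta> t + 1) t"

definition upper_region :: "braid \<Rightarrow> nat \<Rightarrow> region" where
  "upper_region \<beta> t = region_at \<beta> (col \<beta> t) (Suc t)"

definition epi :: "complex \<Rightarrow> complex" where
  "epi a = exp (of_real pi * \<i> * a)"

text \<open>
  Analytic continuation of \<open>Li\<^sub>2\<close>, starting at \<open>0\<close>, along a path to \<open>z\<close> that avoids the branch
  points \<open>0\<close> and \<open>1\<close>: \<open>v\<close> is the value of \<open>Li\<^sub>2(z)\<close> and \<open>l\<close> the value of \<open>log (1 - z)\<close> that are
  reached.
\<close>

definition dilog_value :: "complex \<Rightarrow> complex \<Rightarrow> complex \<Rightarrow> bool" where
  "dilog_value z v l \<longleftrightarrow>
     (\<exists>\<gamma> g. valid_path \<gamma> \<and> \<gamma> 0 = 0 \<and> \<gamma> 1 = z \<and> (\<forall>t\<in>{0<..1}. \<gamma> t \<noteq> 0 \<and> \<gamma> t \<noteq> 1) \<and>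
        continuous_on {0..1} g \<and> g 0 = 0 \<and> g 1 = l \<and> (\<forall>t\<in>{0..1}. exp (g t) = 1 - \<gamma> t) \<and>
        ((\<lambda>t. - (g t / \<gamma> t) * vector_derivative \<gamma> (at t)) has_integral v) {0..1})"

definition dilog_branch :: "complex \<Rightarrow> (complex \<Rightarrow> complex) \<Rightarrow> bool" where
  "dilog_branch z f \<longleftrightarrow>
     (\<exists>S g. open S \<and> z \<in> S \<and> continuous_on S g \<and>
        (\<forall>s\<in>S. dilog_value s (f s) (g s) \<and> (f has_field_derivative - (g s / s)) (at s)))"

definition log_branch :: "complex \<Rightarrow> (complex \<Rightarrow> complex) \<Rightarrow> bool" where
  "log_branch z f \<longleftrightarrow> (\<exists>S. open S \<and> z \<in> S \<and> continuous_on S f \<and> (\<forall>s\<in>S. exp (f s) = s))"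

definition pos_args ::
    "complex \<Rightarrow> complex \<Rightarrow> complex \<Rightarrow> complex \<Rightarrow> complex \<Rightarrow> complex \<Rightarrow> complex list" where
  "pos_args a b w1 w2 w3 w4 =
     [epi a * (w4 / w3), epi b * (w4 / w1), w2 * w4 / (w1 * w3), epi a * (w1 / w2), epi b * (w3 / w2)]"

definition neg_args ::
    "complex \<Rightarrow> complex \<Rightarrow> complex \<Rightarrow> complex \<Rightarrow> complex \<Rightarrow> complex \<Rightarrow> complex list" where
  "neg_args a b w1 w2 w3 w4 =
     [epi a * (w1 / w4), epi b * (w3 / w4), w2 * w4 / (w1 * w3), epi a * (w2 / w3), epi b * (w2 / w1)]"

text \<open>
  In the following, \<open>l\<close> gives the logarithms of the region variables, \<open>Li\<close> the branches
  chosen for the five dilogarithms and \<open>x\<close> their arguments.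
\<close>

definition pos_potential ::
    "(nat \<Rightarrow> complex \<Rightarrow> complex) \<Rightarrow> complex \<Rightarrow> complex \<Rightarrow> complex list \<Rightarrow>
      complex \<Rightarrow> complex \<Rightarrow> complex \<Rightarrow> complex \<Rightarrow> complex" where
  "pos_potential Li a b x l1 l2 l3 l4 =
     of_real pi * \<i> * ((a + b) / 2) * (l1 + l3 - l2 - l4) - (l2 - l1) * (l3 - l2)
     - Li 0 (x ! 0) - Li 1 (x ! 1) + Li 2 (x ! 2) + Li 3 (x ! 3) + Li 4 (x ! 4)
     - of_real pi ^ 2 / 6"

definition neg_potential ::
    "(nat \<Rightarrow> complex \<Rightarrow> complex) \<Rightarrow> complex \<Rightarrow> complex \<Rightarrow> complex list \<Rightarrow>
      complex \<Rightarrow> complex \<Rightarrow> complex \<Rightarrow> complex \<Rightarrow> complex" where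
  "neg_potential Li a b x l1 l2 l3 l4 =
     - (of_real pi * \<i> * ((a + b) / 2) * (l1 + l3 - l2 - l4)) + (l3 - l4) * (l4 - l1)
     - Li 0 (x ! 0) - Li 1 (x ! 1) - Li 2 (x ! 2) + Li 3 (x ! 3) + Li 4 (x ! 4)
     + of_real pi ^ 2 / 6"

definition over_param :: "braid \<Rightarrow> (nat \<Rightarrow> complex) \<Rightarrow> nat \<Rightarrow> complex" where
  "over_param \<beta> a t = a (component \<beta> t (over_in \<beta> t))"

definition under_param :: "braid \<Rightarrow> (nat \<Rightarrow> complex) \<Rightarrow> nat \<Rightarrow> complex" where
  "under_param \<beta> a t = a (component \<beta> t (under_in \<beta> t))"

definition crossing_args ::
    "braid \<Rightarrow> nat \<Rightarrow> (nat \<Rightarrow> complex) \<Rightarrow> (region \<Rightarrow> complex) \<Rightarrow> complex list" where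
  "crossing_args \<beta> t a w =
     (if positive \<beta> t then pos_args else neg_args) (over_param \<beta> a t) (under_param \<beta> a t)
       (w (left_region \<beta> t)) (w (lower_region \<beta> t)) (w (right_region \<beta> t)) (w (upper_region \<beta> t))"

definition crossing_potential ::
    "braid \<Rightarrow> (region \<Rightarrow> complex \<Rightarrow> complex) \<Rightarrow> (nat \<Rightarrow> complex \<Rightarrow> complex) \<Rightarrow> nat \<Rightarrow>
      (nat \<Rightarrow> complex) \<Rightarrow> (region \<Rightarrow> complex) \<Rightarrow> complex" where
  "crossing_potential \<beta> lg Li t a w =
     (let l = (\<lambda>r. lg r (w r)); same = (component \<beta> t (over_in \<beta> t) = component \<beta> t (under_in \<beta> t))
      in (if positive \<beta> t then pos_potential else neg_potential) Li
           (over_param \<beta> a t) (under_param \<beta> a t) (crossing_args \<beta> t a w)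
           (l (left_region \<beta> t)) (l (lower_region \<beta> t)) (l (right_region \<beta> t)) (l (upper_region \<beta> t))
         + (if same then (if positive \<beta> t then 1 else -1) * (of_real pi * \<i> * over_param \<beta> a t) ^ 2
            else 0))"

text \<open>
  \<open>\<Phi>\<close> is a branch, near the point \<open>(a, w)\<close>, of the multivalued potential function.
  All logarithms of monomials in the region variables come from one choice of the
  logarithms of these variables, so that for instance \<open>log (w\<^sub>2 / w\<^sub>1) = log w\<^sub>2 - log w\<^sub>1\<close>;
  this property is preserved by analytic continuation in \<open>w\<close>.  With independent choices of
  \<open>log (w\<^sub>1 w\<^sub>3 / (w\<^sub>2 w\<^sub>4))\<close> at the crossings, the value of \<open>exp ((1 / (\<pi> i)) \<partial>\<Phi>/\<partial>a\<^sub>j)\<close> would be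
  defined only up to sign, because of the factor \<open>(a + b) / 2\<close>.
\<close>

definition potential_branch ::
    "nat \<Rightarrow> braid \<Rightarrow> (nat \<Rightarrow> complex) \<Rightarrow> (region \<Rightarrow> complex) \<Rightarrow>
      ((nat \<Rightarrow> complex) \<Rightarrow> (region \<Rightarrow> complex) \<Rightarrow> complex) \<Rightarrow> bool" where
  "potential_branch m \<beta> a w \<Phi> \<longleftrightarrow>
     (\<exists>lg Li. (\<forall>r\<in>regions m \<beta>. log_branch (w r) (lg r)) \<and>
        (\<forall>t<length \<beta>. \<forall>k<5. dilog_branch (crossing_args \<beta> t a w ! k) (Li t k)) \<and>
        \<Phi> = (\<lambda>a w. \<Sum>t<length \<beta>. crossing_potential \<beta> lg (Li t) t a w))"

text \<open>
  The equations hold for one branch of \<open>\<Phi>\<close> iff they hold for all; a branch exists iff the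
  point is not a singularity of \<open>\<Phi>\<close>, i.e. the \<open>w i\<close> are nonzero and no modulus is \<open>1\<close>.
\<close>

definition w_saddle_point ::
    "nat \<Rightarrow> braid \<Rightarrow> (nat \<Rightarrow> complex) \<Rightarrow> (region \<Rightarrow> complex) \<Rightarrow> bool" where
  "w_saddle_point m \<beta> a w \<longleftrightarrow>
     (\<exists>\<Phi>. potential_branch m \<beta> a w \<Phi>) \<and>
     (\<forall>\<Phi>. potential_branch m \<beta> a w \<Phi> \<longrightarrow>
        (\<forall>i\<in>regions m \<beta>. exp (w i * deriv (\<lambda>z. \<Phi> a (w(i := z))) (w i)) = 1))"

definition saddle_point ::
    "nat \<Rightarrow> braid \<Rightarrow> (nat \<Rightarrow> complex) \<Rightarrow> (region \<Rightarrow> complex) \<Rightarrow> bool" where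
  "saddle_point m \<beta> a w \<longleftrightarrow>
     (\<exists>\<Phi>. potential_branch m \<beta> a w \<Phi>) \<and>
     (\<forall>\<Phi>. potential_branch m \<beta> a w \<Phi> \<longrightarrow>
        (\<forall>i\<in>regions m \<beta>. exp (w i * deriv (\<lambda>z. \<Phi> a (w(i := z))) (w i)) = 1) \<and>
        (\<forall>j\<in>link_components m \<beta>.
           exp (1 / (of_real pi * \<i>) * deriv (\<lambda>z. \<Phi> (a(j := z)) w) (a j)) = 1))"

text \<open>
  In \<open>complex \<times> real\<close> the first entry is a point of the plane of the diagram and the second one
  the height above it.  Position \<open>i\<close> is the circle of radius \<open>i + 1\<close>, the upward direction is
  the counterclockwise one, and crossing \<open>t\<close> occupies the angles between \<open>2 \<pi> t / N\<close> and
  \<open>2 \<pi> (t + 1) / N\<close>, where \<open>N\<close> is the number of crossings.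
\<close>

definition strand_plane :: "braid \<Rightarrow> nat \<Rightarrow> nat \<Rightarrow> real \<Rightarrow> complex" where
  "strand_plane \<beta> t i s =
     of_real (1 + real i + s * (real (step \<beta> t i) - real i))
       * cis (2 * pi * (real t + s) / real (length \<beta>))"

definition strand_height :: "braid \<Rightarrow> nat \<Rightarrow> nat \<Rightarrow> real \<Rightarrow> real" where
  "strand_height \<beta> t i s =
     (if i = over_in \<beta> t then 4 * s * (1 - s)
      else if i = under_in \<beta> t then - (4 * s * (1 - s)) else 0)"

definition closed_braid :: "nat \<Rightarrow> braid \<Rightarrow> (complex \<times> real) set" where
  "closed_braid m \<beta> =
     (\<Union>t<length \<beta>. \<Union>i<m. (\<lambda>s. (strand_plane \<beta> t i s, strand_height \<beta> t i s)) ` {0..1})"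

definition stereo :: "complex \<times> real \<Rightarrow> (complex \<times> real) \<times> real" where
  "stereo x = ((2 / ((norm x)\<^sup>2 + 1)) *\<^sub>R x, ((norm x)\<^sup>2 - 1) / ((norm x)\<^sup>2 + 1))"

definition link :: "nat \<Rightarrow> braid \<Rightarrow> ((complex \<times> real) \<times> real) set" where
  "link m \<beta> = stereo ` closed_braid m \<beta>"

definition link_complement :: "nat \<Rightarrow> braid \<Rightarrow> ((complex \<times> real) \<times> real) set" where
  "link_complement m \<beta> = sphere 0 1 - link m \<beta>"

definition plus_infinity :: "(complex \<times> real) \<times> real" where
  "plus_infinity = stereo (0, 3)"

definition minus_infinity :: "(complex \<times> real) \<times> real" where
  "minus_infinity = stereo (0, -3)"

definition H3 :: "(complex \<times> real) set" where
  "H3 = {x. 0 < snd x}"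

definition SL2 :: "(complex^2^2) set" where
  "SL2 = {A. det A = 1}"

text \<open>The Poincare extension, for matrices of determinant 1.\<close>

definition moebius :: "complex^2^2 \<Rightarrow> complex \<times> real \<Rightarrow> complex \<times> real" where
  "moebius A x =
     (let a = A$1$1; b = A$1$2; c = A$2$1; d = A$2$2; z = fst x; t = snd x;
          n = (cmod (c * z + d))\<^sup>2 + (cmod c)\<^sup>2 * t\<^sup>2
      in (((a * z + b) * cnj (c * z + d) + a * cnj c * of_real (t\<^sup>2)) / of_real n, t / n))"

definition deck :: "'a::topological_space set \<Rightarrow> ('a \<Rightarrow> 'b) \<Rightarrow> ('a \<Rightarrow> 'a) set" where
  "deck U p = {g. (\<exists>h. homeomorphism U U g h) \<and> (\<forall>u\<in>U. p (g u) = p u)}"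

text \<open>
  A (possibly non-complete) hyperbolic structure on \<open>X\<close> as a \<open>(PSL(2,\<complex>), H3)\<close>-structure,
  presented by a universal covering \<open>p : U \<rightarrow> X\<close> and a developing map: a local
  homeomorphism \<open>U \<rightarrow> H3\<close> that is equivariant for some holonomy.  It is complete iff the
  developing map is a covering.
\<close>

definition hyperbolic_structure ::
    "'b::topological_space set \<Rightarrow> (complex \<times> real) set \<Rightarrow> (complex \<times> real \<Rightarrow> 'b) \<Rightarrow>
      (complex \<times> real \<Rightarrow> complex \<times> real) \<Rightarrow> bool" where
  "hyperbolic_structure X U p dev \<longleftrightarrow>
     simply_connected U \<and> covering_space U p X \<and> dev ` U \<subseteq> H3 \<and>
     (\<forall>u\<in>U. \<exists>T h. u \<in> T \<and> openin (top_of_set U) T \<and> open (dev ` T) \<and>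
        homeomorphism T (dev ` T) dev h) \<and>
     (\<forall>g\<in>deck U p. \<exists>A\<in>SL2. \<forall>u\<in>U. dev (g u) = moebius A (dev u))"

definition complete_structure ::
    "(complex \<times> real) set \<Rightarrow> (complex \<times> real \<Rightarrow> complex \<times> real) \<Rightarrow> bool" where
  "complete_structure U dev \<longleftrightarrow> covering_space U dev H3"

text \<open>\<open>X = H3 / \<Gamma>\<close> with quotient map \<open>q\<close>; as \<open>q\<close> is a covering, \<open>\<Gamma>\<close> acts freely and discretely.\<close>

definition hyperbolic_quotient ::
    "'b::topological_space set \<Rightarrow> (complex^2^2) set \<Rightarrow> (complex \<times> real \<Rightarrow> 'b) \<Rightarrow> bool" where
  "hyperbolic_quotient X \<Gamma> q \<longleftrightarrow>
     \<Gamma> \<subseteq> SL2 \<and> mat 1 \<in> \<Gamma> \<and> (\<forall>A\<in>\<Gamma>. \<forall>B\<in>\<Gamma>. A ** B \<in> \<Gamma>) \<and> (\<forall>A\<in>\<Gamma>. matrix_inv A \<in> \<Gamma>) \<and>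
     covering_space H3 q X \<and>
     (\<forall>x\<in>H3. \<forall>y\<in>H3. q x = q y \<longleftrightarrow> (\<exists>A\<in>\<Gamma>. y = moebius A x))"

definition hyperbolic_measure :: "(complex \<times> real) set \<Rightarrow> ennreal" where
  "hyperbolic_measure F = (\<integral>\<^sup>+ x\<in>F. ennreal (1 / (snd x) ^ 3) \<partial>lborel)"

definition quotient_volume ::
    "'b::topological_space set \<Rightarrow> (complex \<times> real \<Rightarrow> 'b) \<Rightarrow> real \<Rightarrow> bool" where
  "quotient_volume X q v \<longleftrightarrow>
     0 \<le> v \<and> (\<exists>F\<in>sets borel. F \<subseteq> H3 \<and> bij_betw q F X \<and> hyperbolic_measure F = ennreal v)"

definition hyperbolic_link :: "nat \<Rightarrow> braid \<Rightarrow> bool" where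
  "hyperbolic_link m \<beta> \<longleftrightarrow>
     (\<exists>\<Gamma> q v. hyperbolic_quotient (link_complement m \<beta>) \<Gamma> q \<and>
        quotient_volume (link_complement m \<beta>) q v)"

text \<open>Unique by Mostow rigidity.\<close>

definition Vol :: "'b::topological_space set \<Rightarrow> real" where
  "Vol X = (THE v. \<exists>\<Gamma> q. hyperbolic_quotient X \<Gamma> q \<and> quotient_volume X q v)"

text \<open>
  Points of the ideal boundary of \<open>H3\<close> are given by nonzero vectors in \<open>\<complex>\<^sup>2\<close>, homogeneous
  coordinates for \<open>z = x$1 / x$2\<close>.  The modulus below is that of the ideal tetrahedron with
  vertices \<open>x0, x1, x2, x3\<close> at the edge \<open>x0 x1\<close> (and \<open>x2 x3\<close>): it equals \<open>z\<close> for the vertices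
  \<open>\<infinity>, 0, 1, z\<close>, and the moduli at \<open>x0 x2\<close> and \<open>x0 x3\<close> are \<open>1 / (1 - z)\<close> and \<open>1 - 1 / z\<close>.
\<close>

definition det2 :: "complex^2 \<Rightarrow> complex^2 \<Rightarrow> complex" where
  "det2 x y = x$1 * y$2 - x$2 * y$1"

definition modulus ::
    "complex^2 \<Rightarrow> complex^2 \<Rightarrow> complex^2 \<Rightarrow> complex^2 \<Rightarrow> complex" where
  "modulus x0 x1 x2 x3 = (det2 x3 x1 * det2 x2 x0) / (det2 x2 x1 * det2 x3 x0)"

text \<open>
  The rays from the centre of the octahedron at crossing \<open>t\<close>, which lies between the two
  strands, to its six vertices: up to the over-strand (\<open>E\<close>), down to the under-strand (\<open>F\<close>), and
  along (the projection of) strand \<open>i\<close>, backwards (\<open>s = 1/4\<close>) or forwards (\<open>s = 3/4\<close>), and then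
  away from that strand, down to minus infinity for the over-strand (\<open>A\<close>, \<open>C\<close>; \<open>h = -1\<close>) or up to
  plus infinity for the under-strand (\<open>B\<close>, \<open>D\<close>; \<open>h = 1\<close>).
\<close>

definition centre :: "braid \<Rightarrow> nat \<Rightarrow> complex" where
  "centre \<beta> t = strand_plane \<beta> t (over_in \<beta> t) (1/2)"

definition vertical_ray :: "braid \<Rightarrow> nat \<Rightarrow> real \<Rightarrow> real \<Rightarrow> (complex \<times> real) \<times> real" where
  "vertical_ray \<beta> t h = stereo \<circ> linepath (centre \<beta> t, 0) (centre \<beta> t, h)"

definition hooked_ray ::
    "braid \<Rightarrow> nat \<Rightarrow> nat \<Rightarrow> real \<Rightarrow> real \<Rightarrow> real \<Rightarrow> (complex \<times> real) \<times> real" where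
  "hooked_ray \<beta> t i s h =
     stereo \<circ> ((\<lambda>x. (strand_plane \<beta> t i (1/2 + x * (s - 1/2)), 0)) +++
       (linepath (strand_plane \<beta> t i s, 0) (strand_plane \<beta> t i s, 2 * h) +++
        linepath (strand_plane \<beta> t i s, 2 * h) (0, 3 * h)))"

text \<open>
  \<open>V\<close> assigns ideal points to the ends of the universal covering over the link and over
  \<open>\<plusminus>\<infinity>\<close>; \<open>x\<close> is the ideal point of the end that is reached by the lift of \<open>\<gamma>\<close> starting at \<open>u\<close>.
\<close>

definition ideal_endpoint ::
    "(complex \<times> real) set \<Rightarrow> (complex \<times> real \<Rightarrow> 'b) \<Rightarrow> (complex \<times> real \<Rightarrow> complex^2) \<Rightarrow>
      complex \<times> real \<Rightarrow> (real \<Rightarrow> 'b) \<Rightarrow> complex^2 \<Rightarrow> bool" where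
  "ideal_endpoint U p V u \<gamma> x \<longleftrightarrow>
     (\<exists>h. continuous_on {0..<1} h \<and> h 0 = u \<and> (\<forall>s\<in>{0..<1}. h s \<in> U \<and> p (h s) = \<gamma> s) \<and>
        (\<forall>\<^sub>F s in at_left 1. V (h s) = x))"

text \<open>
  The edges \<open>DA, AB, BC, CD\<close> pass through the left, lower, right and upper region in a positive
  crossing, and through the right, lower, left and upper region in a negative one.  The order of
  the vertices is determined by the edges at which the modulus, \<open>z'\<close> and \<open>z''\<close> occur: at the
  central edges \<open>BD\<close> and \<open>AC\<close>, and in the products of edge parameters at the four edges above.
\<close>

definition positive_moduli ::
    "complex \<Rightarrow> complex \<Rightarrow> complex \<Rightarrow> complex \<Rightarrow> complex \<Rightarrow> complex \<Rightarrow>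
      complex^2 \<Rightarrow> complex^2 \<Rightarrow> complex^2 \<Rightarrow> complex^2 \<Rightarrow> complex^2 \<Rightarrow> complex^2 \<Rightarrow> bool" where
  "positive_moduli a b w1 w2 w3 w4 E F A B C D \<longleftrightarrow>
     modulus E A B D = epi a * (w1 / w2) \<and>
     modulus E C D B = inverse (epi a) * (w3 / w4) \<and>
     modulus A C B D = w2 * w4 / (w1 * w3) \<and>
     modulus F D C A = inverse (epi b) * (w1 / w4) \<and>
     modulus F B A C = epi b * (w3 / w2)"

definition negative_moduli ::
    "complex \<Rightarrow> complex \<Rightarrow> complex \<Rightarrow> complex \<Rightarrow> complex \<Rightarrow> complex \<Rightarrow>
      complex^2 \<Rightarrow> complex^2 \<Rightarrow> complex^2 \<Rightarrow> complex^2 \<Rightarrow> complex^2 \<Rightarrow> complex^2 \<Rightarrow> bool" where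
  "negative_moduli a b w1 w2 w3 w4 E F A B C D \<longleftrightarrow>
     modulus E C B D = inverse (epi a) * (w4 / w1) \<and>
     modulus E A D B = epi a * (w2 / w3) \<and>
     modulus A C D B = w1 * w3 / (w2 * w4) \<and>
     modulus F B C A = epi b * (w2 / w1) \<and>
     modulus F D A C = inverse (epi b) * (w4 / w3)"

text \<open>
  The hyperbolic structure given by ideal tetrahedra with the prescribed moduli.  As the
  triangulation has \<open>\<plusminus>\<infinity>\<close> among its ideal vertices, some of the tetrahedra are necessarily
  flat or negatively oriented, so the structure is described by straightening: the ends over the
  link and over \<open>\<plusminus>\<infinity>\<close> are mapped to ideal points, equivariantly for the holonomy of the
  developing map, and for every lift of every octahedron the ideal tetrahedra spanned by the
  images of its vertices have the given moduli.  An end is a connected subset of \<open>U\<close> lying over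
  a neighbourhood \<open>W\<close> of the link and \<open>\<plusminus>\<infinity>\<close>.
\<close>

definition gives_structure ::
    "nat \<Rightarrow> braid \<Rightarrow> (nat \<Rightarrow> complex) \<Rightarrow> (region \<Rightarrow> complex) \<Rightarrow> (complex \<times> real) set \<Rightarrow>
      (complex \<times> real \<Rightarrow> (complex \<times> real) \<times> real) \<Rightarrow> (complex \<times> real \<Rightarrow> complex \<times> real) \<Rightarrow>
      (complex \<times> real \<Rightarrow> complex^2) \<Rightarrow> bool" where
  "gives_structure m \<beta> a w U p dev V \<longleftrightarrow>
     hyperbolic_structure (link_complement m \<beta>) U p dev \<and>
     (\<exists>W. open W \<and> link m \<beta> \<union> {plus_infinity, minus_infinity} \<subseteq> W \<and>
        (\<forall>u\<in>U. p u \<in> W \<longrightarrow> V u \<noteq> 0) \<and>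
        (\<forall>K\<subseteq>U. connected K \<and> p ` K \<subseteq> W \<longrightarrow> V constant_on K) \<and>
        (\<forall>g\<in>deck U p. \<forall>M\<in>SL2. (\<forall>u\<in>U. dev (g u) = moebius M (dev u)) \<longrightarrow>
           (\<forall>u\<in>U. p u \<in> W \<longrightarrow> (\<exists>c. c \<noteq> 0 \<and> V (g u) = c *s (M *v V u))))) \<and>
     (\<forall>t<length \<beta>. \<forall>u\<in>U. p u = stereo (centre \<beta> t, 0) \<longrightarrow>
        (\<exists>E F A B C D.
           ideal_endpoint U p V u (vertical_ray \<beta> t 1) E \<and>
           ideal_endpoint U p V u (vertical_ray \<beta> t (-1)) F \<and>
           ideal_endpoint U p V u (hooked_ray \<beta> t (over_in \<beta> t) (1/4) (-1)) A \<and>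
           ideal_endpoint U p V u (hooked_ray \<beta> t (under_in \<beta> t) (1/4) 1) B \<and>
           ideal_endpoint U p V u (hooked_ray \<beta> t (over_in \<beta> t) (3/4) (-1)) C \<and>
           ideal_endpoint U p V u (hooked_ray \<beta> t (under_in \<beta> t) (3/4) 1) D \<and>
           (if positive \<beta> t then positive_moduli else negative_moduli)
             (over_param \<beta> a t) (under_param \<beta> a t)
             (w (left_region \<beta> t)) (w (lower_region \<beta> t))
             (w (right_region \<beta> t)) (w (upper_region \<beta> t)) E F A B C D))"

text \<open>
  The structure \<open>(U, p, dev)\<close> is the one of \<open>X = H3 / \<Gamma>\<close>, of volume \<open>Vol X\<close>, for some \<open>\<Gamma>\<close>.
\<close>

definition finite_volume_structure ::
    "'b::topological_space set \<Rightarrow> (complex \<times> real) set \<Rightarrow> (complex \<times> real \<Rightarrow> 'b) \<Rightarrow>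
      (complex \<times> real \<Rightarrow> complex \<times> real) \<Rightarrow> bool" where
  "finite_volume_structure X U p dev \<longleftrightarrow>
     (\<exists>\<Gamma> q. hyperbolic_quotient X \<Gamma> q \<and> quotient_volume X q (Vol X) \<and> (\<forall>u\<in>U. q (dev u) = p u))"

end

theory Submission
  imports Defs "HOL-Combinatorics.Cycles"
begin

text \<open>
  Let \<open>l\<close> be the chosen logarithms of the region variables and give an arc with left region
  \<open>r\<close> and right region \<open>r'\<close> the weight \<open>cosh ((l r - l r') / 2)\<close>.  At \<open>\<bold>a = \<bold>1\<close> we have
  \<open>e\<^sub>a = -1\<close>, so the derivatives of the dilogarithms by \<open>a\<close> are logarithms of sums like
  \<open>1 + w\<^sub>4 / w\<^sub>3\<close>.  Together with the factor \<open>(w\<^sub>1 w\<^sub>3 / (w\<^sub>2 w\<^sub>4))\<^sup>1\<^sup>/\<^sup>2\<close> they say that a strand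
  through a crossing contributes the weight of its outgoing arc divided by the weight of its
  incoming arc.  Along a closed component the product of these quotients telescopes to \<open>1\<close>.
  For completeness, the developing map is a map between two universal coverings of the link
  complement, hence a homeomorphism.
\<close>

section \<open>Lifts between simply connected coverings\<close>

text \<open>Since \<open>H\<close> is simply connected and locally path connected, \<open>q\<close>
  lifts through \<open>p\<close> to a map \<open>g\<close> with a prescribed value at one point.
  Both composites of \<open>f\<close> and \<open>g\<close> are lifts of a covering projection
  through itself that fix a point, so uniqueness of lifts makes them identities.\<close>

lemma covering_lift_homeomorphism:
  fixes p :: "'a::real_normed_vector \<Rightarrow> 'b::real_normed_vector"
    and q :: "'c::real_normed_vector \<Rightarrow> 'b"
  assumes p: "covering_space U p X" and q: "covering_space H q X"
    and U: "connected U" and H: "simply_connected H" "locally path_connected H"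
    and ne: "U \<noteq> {}"
    and f: "continuous_on U f" "f \<in> U \<rightarrow> H" "\<And>u. u \<in> U \<Longrightarrow> q (f u) = p u"
  obtains g where "homeomorphism U H f g"
proof -
  obtain u0 where u0: "u0 \<in> U" using ne by auto
  have fu0: "f u0 \<in> H" using f u0 by auto
  have contq: "continuous_on H q" and qim: "q \<in> H \<rightarrow> X"
    using covering_space_imp_continuous[OF q] covering_space_imp_surjective[OF q] by auto
  have contp: "continuous_on U p" and pim: "p \<in> U \<rightarrow> X"
    using covering_space_imp_continuous[OF p] covering_space_imp_surjective[OF p] by auto
  obtain g where g: "continuous_on H g" "g \<in> H \<rightarrow> U" "g (f u0) = u0"
    "\<And>y. y \<in> H \<Longrightarrow> p (g y) = q y"
    using covering_space_lift_strong[OF p u0 fu0 H contq qim] f(3)[OF u0] by metis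
  have gf: "g (f u) = u" if "u \<in> U" for u
  proof (rule covering_space_lift_unique[OF p _ contp pim _ _ _ _ _ _ U u0 that])
    show "continuous_on U (\<lambda>u. g (f u))"
      using f g by (intro continuous_on_compose2[OF g(1) f(1)]) auto
  qed (use f g in \<open>auto simp: Pi_iff\<close>)
  have fg: "f (g x) = x" if "x \<in> H" for x
  proof (rule covering_space_lift_unique[OF q _ contq qim _ _ _ _ _ _ _ fu0 that])
    show "continuous_on H (\<lambda>u. f (g u))"
      using f g by (intro continuous_on_compose2[OF f(1) g(1)]) auto
    show "connected H" by (rule simply_connected_imp_connected[OF H(1)])
    show "q x = q (f (g x))" if "x \<in> H" for x
      using f(3)[of "g x"] g(4)[OF that] funcset_mem[OF g(2) that] by simp
  qed (use f g in \<open>auto simp: Pi_iff\<close>)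
  have "homeomorphism U H f g"
    using f g gf fg by (intro homeomorphismI) (auto simp: Pi_iff)
  then show thesis by (rule that)
qed

lemma convex_H3: "convex H3"
proof -
  have "H3 = snd -` {0<..}" by (auto simp: H3_def)
  then show ?thesis
    using convex_linear_vimage[of "snd :: complex \<times> real \<Rightarrow> real" "{0<..}"] linear_snd by simp
qed

text \<open>The relation \<open>q (dev u) = p u\<close> makes \<open>dev\<close> a lift of
  \<open>p\<close> through the quotient covering by \<open>H3\<close>. Convexity of
  \<open>H3\<close> supplies what the lifting lemma asks of the base, so \<open>dev\<close> is a
  homeomorphism and in particular a covering.\<close>

lemma finite_volume_imp_complete:
  fixes X :: "'b::real_normed_vector set"
  assumes hs: "hyperbolic_structure X U p dev"
    and fv: "finite_volume_structure X U p dev"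
  shows "complete_structure U dev"
proof -
  obtain \<Gamma> q where q: "covering_space H3 q X" "\<forall>u\<in>U. q (dev u) = p u"
    using fv unfolding finite_volume_structure_def hyperbolic_quotient_def by blast
  have p: "covering_space U p X" and U: "simply_connected U" and im: "dev ` U \<subseteq> H3"
    using hs unfolding hyperbolic_structure_def by blast+
  \<comment> \<open>The lift needs a base point in \<open>U\<close>; it comes from a point of
    \<open>H3\<close> through the two surjections onto \<open>X\<close>.\<close>
  have "(0, 1) \<in> H3" by (simp add: H3_def)
  then have "X \<noteq> {}" using covering_space_imp_surjective[OF q(1)] by auto
  then have ne: "U \<noteq> {}" using covering_space_imp_surjective[OF p] by auto
  have cont: "continuous_on U dev"
  proof (subst continuous_on_eq_continuous_within, rule ballI)
    fix u assume "u \<in> U"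
    then obtain T h where T: "u \<in> T" "openin (top_of_set U) T" "homeomorphism T (dev ` T) dev h"
      using hs unfolding hyperbolic_structure_def by blast
    then have c: "continuous (at u within T) dev"
      unfolding homeomorphism_def continuous_on_eq_continuous_within by blast
    \<comment> \<open>Near \<open>u\<close> the sets \<open>T\<close> and \<open>U\<close> agree, so
      continuity within \<open>T\<close> passes to \<open>U\<close>.\<close>
    obtain S where S: "open S" "T = U \<inter> S" using T(2) by (auto simp: openin_open)
    have "at u within T = at u within U"
      using T(1) S by (intro at_within_nhd[of u S]) auto
    then show "continuous (at u within U) dev" using c by simp
  qed
  obtain h where "homeomorphism U H3 dev h"
    using covering_lift_homeomorphism[OF p q(1) simply_connected_imp_connected[OF U]
        convex_imp_simply_connected[OF convex_H3] convex_imp_locally_path_connected[OF convex_H3]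
        ne cont] im q(2) by blast
  then show ?thesis
    unfolding complete_structure_def by (rule homeomorphism_imp_covering_space)
qed

section \<open>Derivatives of the crossing potentials\<close>

lemma dilog_value_imp:
  assumes "dilog_value z v l"
  shows "exp l = 1 - z \<and> z \<noteq> 0"
  using assms unfolding dilog_value_def
proof (elim exE conjE)
  fix \<gamma> g
  assume "\<forall>t\<in>{0..1}. exp (g t) = 1 - \<gamma> t" "\<forall>t\<in>{0<..1}. \<gamma> t \<noteq> 0 \<and> \<gamma> t \<noteq> (1::complex)"
    and z: "\<gamma> (1::real) = z" "g 1 = l"
  from this(1,2)[THEN bspec, of 1] show ?thesis using z by simp
qed

text \<open>Only the exponential of \<open>g\<close>, the value reached by
  \<open>log (1 - z)\<close>, matters later, so the path of continuation can be forgotten. The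
  equation for \<open>exp g\<close> also excludes \<open>z = 1\<close>, which is why the weights at
  a crossing do not vanish.\<close>

lemma dilog_branch_derivative:
  assumes "dilog_branch z f"
  obtains g where "exp g = 1 - z" "z \<noteq> 0" "(f has_field_derivative - (g / z)) (at z)"
proof -
  obtain S g where S: "z \<in> S"
    "\<forall>s\<in>S. dilog_value s (f s) (g s) \<and> (f has_field_derivative - (g s / s)) (at s)"
    using assms unfolding dilog_branch_def by blast
  then have "exp (g z) = 1 - z" "z \<noteq> 0" using dilog_value_imp by blast+
  then show thesis using S that by blast
qed

lemma epi_1 [simp]: "epi 1 = -1"
  by (simp add: epi_def)

text \<open>The inner derivative is a multiple of the argument itself and cancels the denominator in
  the derivative of the dilogarithm. The function \<open>A\<close> is a strand's parameter in terms
  of the one being varied, so that \<alpha> will be 1 or 0.\<close>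

lemma dilog_param_derivative:
  assumes A: "(A has_field_derivative \<alpha>) (at 1)" "A 1 = 1"
    and Li: "dilog_branch (epi 1 * c) f"
  obtains g where "exp g = 1 + c"
    "((\<lambda>z. f (epi (A z) * c)) has_field_derivative - (of_real pi * \<i> * \<alpha> * g)) (at 1)"
proof -
  obtain g where g: "exp g = 1 - epi 1 * c" "epi 1 * c \<noteq> 0"
    "(f has_field_derivative - (g / (epi 1 * c))) (at (epi 1 * c))"
    using dilog_branch_derivative[OF Li] .
  have "((\<lambda>z. epi (A z) * c) has_field_derivative (of_real pi * \<i> * \<alpha>) * (epi 1 * c)) (at 1)"
    unfolding epi_def
    by (rule derivative_eq_intros A(1) refl)+ (use A(2) in \<open>simp add: algebra_simps\<close>)
  moreover have "(f has_field_derivative - (g / (epi 1 * c))) (at (epi (A 1) * c))"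
    using g(3) A(2) by simp
  ultimately have "((\<lambda>z. f (epi (A z) * c)) has_field_derivative
      - (g / (epi 1 * c)) * ((of_real pi * \<i> * \<alpha>) * (epi 1 * c))) (at 1)"
    by (rule DERIV_chain2[rotated])
  moreover have "- (g / (epi 1 * c)) * ((of_real pi * \<i> * \<alpha>) * (epi 1 * c))
      = - (of_real pi * \<i> * \<alpha> * g)"
    using g(2) by (simp add: field_simps)
  ultimately show thesis using that[of g] g(1) by simp
qed

text \<open>With \<open>w = exp l\<close> and \<open>w' = exp l'\<close> this is
  \<open>(w + w') / (2 * sqrt (w * w'))\<close>, where the logarithms fix the square root.\<close>

definition weight :: "complex \<Rightarrow> complex \<Rightarrow> complex" where
  "weight l l' = cosh ((l - l') / 2)"

lemma weight_commute: "weight l l' = weight l' l"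
  unfolding weight_def by (metis cosh_minus minus_diff_eq minus_divide_left)

text \<open>Pulling the half exponent out of \<open>1 + exp (x - y)\<close> leaves twice a weight;
  the half exponents cancel the first summand and the factors 2 cancel each other. The weights are
  nonzero because exponentials are.\<close>

lemma exp_weight_quotient:
  assumes g: "exp g = 1 + exp (a - b)" and h: "exp h = 1 + exp (c - d)"
  shows "exp (((c - d) - (a - b)) / 2 + g - h) = weight a b / weight c d"
    and "weight a b \<noteq> 0" "weight c d \<noteq> 0"
proof -
  have *: "1 + exp (x - y) = 2 * weight x y * exp ((x - y) / 2)" for x y
    by (simp add: weight_def cosh_field_def algebra_simps flip: exp_add)
  show "weight a b \<noteq> 0" "weight c d \<noteq> 0"
    using g h exp_not_eq_zero[of g] exp_not_eq_zero[of h] by (auto simp: *)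
  have "exp (((c - d) - (a - b)) / 2 + g - h)
      = exp ((c - d) / 2) / exp ((a - b) / 2) * exp g / exp h"
    by (simp only: diff_divide_distrib exp_add exp_diff times_divide_eq_right times_divide_eq_left)
  also have "\<dots> = weight a b / weight c d"
    unfolding g h * by (simp add: field_simps)
  finally show "exp (((c - d) - (a - b)) / 2 + g - h) = weight a b / weight c d" .
qed

lemma nth_five:
  "[x0, x1, x2, x3, x4] ! 0 = x0" "[x0, x1, x2, x3, x4] ! 1 = x1" "[x0, x1, x2, x3, x4] ! 2 = x2"
  "[x0, x1, x2, x3, x4] ! 3 = x3" "[x0, x1, x2, x3, x4] ! 4 = x4"
  by simp_all

text \<open>\<open>X\<close> belongs to the over-strand, which enters between regions 1 and 2 and
  leaves between 4 and 3; \<open>Y\<close> belongs to the under-strand, which enters between 2 and 3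
  and leaves between 1 and 4. The term \<open>Li 2\<close> is free of the parameters.\<close>

lemma pos_potential_derivative:
  assumes A: "(A has_field_derivative \<alpha>) (at 1)" "A 1 = 1"
    and B: "(B has_field_derivative \<beta>) (at 1)" "B 1 = 1"
    and Li: "\<forall>k<5. dilog_branch (pos_args 1 1 (exp l1) (exp l2) (exp l3) (exp l4) ! k) (Li k)"
  obtains X Y where
    "((\<lambda>z. pos_potential Li (A z) (B z)
        (pos_args (A z) (B z) (exp l1) (exp l2) (exp l3) (exp l4)) l1 l2 l3 l4)
      has_field_derivative of_real pi * \<i> * (\<alpha> * X + \<beta> * Y)) (at 1)"
    "exp X = weight l4 l3 / weight l1 l2" "exp Y = weight l1 l4 / weight l2 l3"
    "weight l4 l3 \<noteq> 0" "weight l1 l2 \<noteq> 0" "weight l1 l4 \<noteq> 0" "weight l2 l3 \<noteq> 0"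
proof -
  have Lik: "dilog_branch (epi 1 * (exp l4 / exp l3)) (Li 0)" "dilog_branch (epi 1 * (exp l4 / exp l1)) (Li 1)"
     "dilog_branch (epi 1 * (exp l1 / exp l2)) (Li 3)" "dilog_branch (epi 1 * (exp l3 / exp l2)) (Li 4)"
    using Li[rule_format, of 0] Li[rule_format, of 1] Li[rule_format, of 3] Li[rule_format, of 4]
    by (simp_all add: pos_args_def)
  obtain g0 where g0: "exp g0 = 1 + (exp l4 / exp l3)"
    "((\<lambda>z. Li 0 (epi (A z) * (exp l4 / exp l3))) has_field_derivative - (of_real pi * \<i> * \<alpha> * g0)) (at 1)"
    using dilog_param_derivative[OF A Lik(1)] .
  obtain g1 where g1: "exp g1 = 1 + (exp l4 / exp l1)"
    "((\<lambda>z. Li 1 (epi (B z) * (exp l4 / exp l1))) has_field_derivative - (of_real pi * \<i> * \<beta> * g1)) (at 1)"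
    using dilog_param_derivative[OF B Lik(2)] .
  obtain g3 where g3: "exp g3 = 1 + (exp l1 / exp l2)"
    "((\<lambda>z. Li 3 (epi (A z) * (exp l1 / exp l2))) has_field_derivative - (of_real pi * \<i> * \<alpha> * g3)) (at 1)"
    using dilog_param_derivative[OF A Lik(3)] .
  obtain g4 where g4: "exp g4 = 1 + (exp l3 / exp l2)"
    "((\<lambda>z. Li 4 (epi (B z) * (exp l3 / exp l2))) has_field_derivative - (of_real pi * \<i> * \<beta> * g4)) (at 1)"
    using dilog_param_derivative[OF B Lik(4)] .
  \<comment> \<open>Both first summands are \<open>(l1 + l3 - l2 - l4) / 2\<close>, the share of
    each strand in the term with \<open>(a + b) / 2\<close>, grouped to fit the two dilogarithms of
    that strand.\<close>
  define X where "X = ((l1 - l2) - (l4 - l3)) / 2 + g0 - g3"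
  define Y where "Y = ((l3 - l2) - (l4 - l1)) / 2 + g1 - g4"
  show thesis
  proof (rule that)
    show "((\<lambda>z. pos_potential Li (A z) (B z)
        (pos_args (A z) (B z) (exp l1) (exp l2) (exp l3) (exp l4)) l1 l2 l3 l4)
      has_field_derivative of_real pi * \<i> * (\<alpha> * X + \<beta> * Y)) (at 1)"
      unfolding pos_potential_def pos_args_def nth_five
      by (rule derivative_eq_intros A(1) B(1) g0(2) g1(2) g3(2) g4(2) refl
          | (simp; fail))+
        (simp add: X_def Y_def add_divide_distrib diff_divide_distrib algebra_simps)
    show "exp X = weight l4 l3 / weight l1 l2" "weight l4 l3 \<noteq> 0" "weight l1 l2 \<noteq> 0"
      unfolding X_def using exp_weight_quotient[OF g0(1)[folded exp_diff] g3(1)[folded exp_diff]]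
        by (simp_all)
    show "exp Y = weight l1 l4 / weight l2 l3" "weight l1 l4 \<noteq> 0" "weight l2 l3 \<noteq> 0"
      unfolding Y_def
      using exp_weight_quotient[OF g1(1)[folded exp_diff] g4(1)[folded exp_diff]]
        by (simp_all add: weight_commute[of l4 l1] weight_commute[of l3 l2])
  qed
qed

text \<open>Here the over-strand runs from bottom right to top left, so the two quotients of weights
  change places, and the linear term changes sign.\<close>

lemma neg_potential_derivative:
  assumes A: "(A has_field_derivative \<alpha>) (at 1)" "A 1 = 1"
    and B: "(B has_field_derivative \<beta>) (at 1)" "B 1 = 1"
    and Li: "\<forall>k<5. dilog_branch (neg_args 1 1 (exp l1) (exp l2) (exp l3) (exp l4) ! k) (Li k)"
  obtains X Y where
    "((\<lambda>z. neg_potential Li (A z) (B z)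
        (neg_args (A z) (B z) (exp l1) (exp l2) (exp l3) (exp l4)) l1 l2 l3 l4)
      has_field_derivative of_real pi * \<i> * (\<alpha> * X + \<beta> * Y)) (at 1)"
    "exp X = weight l1 l4 / weight l2 l3" "exp Y = weight l4 l3 / weight l1 l2"
    "weight l4 l3 \<noteq> 0" "weight l1 l2 \<noteq> 0" "weight l1 l4 \<noteq> 0" "weight l2 l3 \<noteq> 0"
proof -
  have Lik: "dilog_branch (epi 1 * (exp l1 / exp l4)) (Li 0)" "dilog_branch (epi 1 * (exp l3 / exp l4)) (Li 1)"
     "dilog_branch (epi 1 * (exp l2 / exp l3)) (Li 3)" "dilog_branch (epi 1 * (exp l2 / exp l1)) (Li 4)"
    using Li[rule_format, of 0] Li[rule_format, of 1] Li[rule_format, of 3] Li[rule_format, of 4]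
    by (simp_all add: neg_args_def)
  obtain g0 where g0: "exp g0 = 1 + (exp l1 / exp l4)"
    "((\<lambda>z. Li 0 (epi (A z) * (exp l1 / exp l4))) has_field_derivative - (of_real pi * \<i> * \<alpha> * g0)) (at 1)"
    using dilog_param_derivative[OF A Lik(1)] .
  obtain g1 where g1: "exp g1 = 1 + (exp l3 / exp l4)"
    "((\<lambda>z. Li 1 (epi (B z) * (exp l3 / exp l4))) has_field_derivative - (of_real pi * \<i> * \<beta> * g1)) (at 1)"
    using dilog_param_derivative[OF B Lik(2)] .
  obtain g3 where g3: "exp g3 = 1 + (exp l2 / exp l3)"
    "((\<lambda>z. Li 3 (epi (A z) * (exp l2 / exp l3))) has_field_derivative - (of_real pi * \<i> * \<alpha> * g3)) (at 1)"
    using dilog_param_derivative[OF A Lik(3)] .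
  obtain g4 where g4: "exp g4 = 1 + (exp l2 / exp l1)"
    "((\<lambda>z. Li 4 (epi (B z) * (exp l2 / exp l1))) has_field_derivative - (of_real pi * \<i> * \<beta> * g4)) (at 1)"
    using dilog_param_derivative[OF B Lik(4)] .
  define X where "X = ((l2 - l3) - (l1 - l4)) / 2 + g0 - g3"
  define Y where "Y = ((l2 - l1) - (l3 - l4)) / 2 + g1 - g4"
  show thesis
  proof (rule that)
    show "((\<lambda>z. neg_potential Li (A z) (B z)
        (neg_args (A z) (B z) (exp l1) (exp l2) (exp l3) (exp l4)) l1 l2 l3 l4)
      has_field_derivative of_real pi * \<i> * (\<alpha> * X + \<beta> * Y)) (at 1)"
      unfolding neg_potential_def neg_args_def nth_five
      by (rule derivative_eq_intros A(1) B(1) g0(2) g1(2) g3(2) g4(2) refl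
          | (simp; fail))+
        (simp add: X_def Y_def add_divide_distrib diff_divide_distrib algebra_simps)
    show "exp X = weight l1 l4 / weight l2 l3" "weight l1 l4 \<noteq> 0" "weight l2 l3 \<noteq> 0"
      unfolding X_def using exp_weight_quotient[OF g0(1)[folded exp_diff] g3(1)[folded exp_diff]]
        by (simp_all)
    show "exp Y = weight l4 l3 / weight l1 l2" "weight l4 l3 \<noteq> 0" "weight l1 l2 \<noteq> 0"
      unfolding Y_def
      using exp_weight_quotient[OF g1(1)[folded exp_diff] g4(1)[folded exp_diff]]
        by (simp_all add: weight_commute[of l2 l1] weight_commute[of l3 l4])
  qed
qed

section \<open>Arcs and components\<close>

lemma braid_word_col:
  assumes "braid_word m \<beta>" "t < length \<beta>"
  shows "1 \<le> col \<beta> t" "col \<beta> t < m"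
  using assms nth_mem[of t \<beta>] unfolding braid_word_def col_def by (auto simp: case_prod_beta)

lemma step_eq_transpose: "step \<beta> t = Transposition.transpose (col \<beta> t - 1) (col \<beta> t)"
  by (auto simp: step_def Transposition.transpose_def)

lemma step_permutes:
  assumes "braid_word m \<beta>" "t < length \<beta>"
  shows "step \<beta> t permutes {..<m}"
  using braid_word_col[OF assms] unfolding step_eq_transpose by (intro permutes_swap_id) auto

lemma track_permutes:
  assumes "braid_word m \<beta>" "t \<le> length \<beta>"
  shows "track \<beta> t permutes {..<m}"
  using assms(2)
proof (induction t)
  case 0
  have "track \<beta> 0 = id" by auto
  then show ?case by (simp only: permutes_id)
next
  case (Suc t)
  have "track \<beta> (Suc t) = step \<beta> t \<circ> track \<beta> t" by auto
  moreover have "step \<beta> t \<circ> track \<beta> t permutes {..<m}"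
    using Suc by (intro permutes_compose step_permutes[OF assms(1)]) auto
  ultimately show ?case by (simp only:)
qed

text \<open>A transposition is injective, so it cancels from the equation that defines the
  label.\<close>

lemma component_step: "component \<beta> (Suc t) (step \<beta> t i) = component \<beta> t i"
  unfolding component_def using inj_eq[of "step \<beta> t"] by (simp add: step_eq_transpose)

text \<open>At the top only positive powers of the closing permutation occur, at the bottom also the
  power 0. Finite order removes the difference.\<close>

lemma component_length:
  assumes "braid_word m \<beta>"
  shows "component \<beta> (length \<beta>) i = component \<beta> 0 i"
proof -
  let ?f = "track \<beta> (length \<beta>)"
  have "permutation ?f"
    using track_permutes[OF assms order_refl] permutation_permutes finite_lessThan by blast
  then obtain k where k: "?f ^^ k = id" "k > 0" by (rule permutation_is_nilpotent)
  have "(\<exists>n. ?f ((?f ^^ n) c) = i) \<longleftrightarrow> (\<exists>n. (?f ^^ n) c = i)" for c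
  proof
    assume "\<exists>n. ?f ((?f ^^ n) c) = i"
    then show "\<exists>n. (?f ^^ n) c = i" by (metis comp_apply funpow.simps(2))
  next
    assume "\<exists>n. (?f ^^ n) c = i"
    then obtain n where "(?f ^^ n) c = i" by auto
    \<comment> \<open>Adding the period \<open>k > 0\<close> to the exponent leaves one application
      to split off, even for \<open>n = 0\<close>.\<close>
    moreover have "Suc (n + k - 1) = n + k" using k(2) by simp
    then have "?f ((?f ^^ (n + k - 1)) c) = (?f ^^ (n + k)) c"
      by (metis comp_apply funpow.simps(2))
    ultimately show "\<exists>n. ?f ((?f ^^ n) c) = i" using k(1) by (auto simp: funpow_add)
  qed
  then show ?thesis unfolding component_def by simp
qed

section \<open>Regions around the closure and weights of arcs\<close>

lemma region_at_in_regions: "k \<le> m \<Longrightarrow> t \<le> length \<beta> \<Longrightarrow> region_at \<beta> k t \<in> regions m \<beta>"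
  unfolding regions_def by blast

text \<open>At level 0 no crossing lies below, and the fallback to the highest crossing of the
  column is the answer at the top level.\<close>

lemma region_at_length: "region_at \<beta> k (length \<beta>) = region_at \<beta> k 0"
  unfolding region_at_def by (auto simp: Let_def)

lemma region_at_Suc: "col \<beta> t \<noteq> k \<Longrightarrow> region_at \<beta> k (Suc t) = region_at \<beta> k t"
  unfolding region_at_def less_Suc_eq by (simp add: conj_disj_distribR cong: conj_cong)

text \<open>
  The weight of an arc that ends at a crossing is nonzero; it is replaced by \<open>1\<close> where it
  vanishes because of the circles without crossings.
\<close>

definition arc_weight :: "(region \<Rightarrow> complex) \<Rightarrow> braid \<Rightarrow> nat \<Rightarrow> nat \<Rightarrow> complex" where
  "arc_weight l \<beta> t i =
     (let W = weight (l (region_at \<beta> i t)) (l (region_at \<beta> (Suc i) t)) in if W = 0 then 1 else W)"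

lemma arc_weight_nonzero [simp]: "arc_weight l \<beta> t i \<noteq> 0"
  by (simp add: arc_weight_def Let_def)

text \<open>The value 1 off the component \<open>j\<close> lets products run over all
  strands.\<close>

definition strand_factor ::
    "(region \<Rightarrow> complex) \<Rightarrow> braid \<Rightarrow> nat \<Rightarrow> nat \<Rightarrow> nat \<Rightarrow> complex" where
  "strand_factor l \<beta> j t i =
     (if component \<beta> t i = j then arc_weight l \<beta> (Suc t) (step \<beta> t i) / arc_weight l \<beta> t i else 1)"

definition level_weight :: "(region \<Rightarrow> complex) \<Rightarrow> nat \<Rightarrow> braid \<Rightarrow> nat \<Rightarrow> nat \<Rightarrow> complex" where
  "level_weight l m \<beta> j t = (\<Prod>i<m. if component \<beta> t i = j then arc_weight l \<beta> t i else 1)"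

text \<open>Reindexing the upper level by \<open>step\<close>, which preserves components, pairs
  outgoing with incoming arcs. Only the two strands that cross contribute to the quotient.\<close>

lemma level_weight_Suc:
  assumes "braid_word m \<beta>" "t < length \<beta>"
  shows "strand_factor l \<beta> j t (col \<beta> t - 1) * strand_factor l \<beta> j t (col \<beta> t)
    = level_weight l m \<beta> j (Suc t) / level_weight l m \<beta> j t"
proof -
  let ?k = "col \<beta> t"
  have k: "1 \<le> ?k" "?k < m" using braid_word_col[OF assms] by auto
  have "level_weight l m \<beta> j (Suc t)
      = (\<Prod>i<m. if component \<beta> t i = j then arc_weight l \<beta> (Suc t) (step \<beta> t i) else 1)"
    unfolding level_weight_def
    by (subst prod.permute[OF step_permutes[OF assms]]) (simp add: component_step o_def)
  then have "level_weight l m \<beta> j (Suc t) / level_weight l m \<beta> j t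
      = (\<Prod>i<m. strand_factor l \<beta> j t i)"
    unfolding level_weight_def
    by (simp add: strand_factor_def flip: prod_dividef) (rule prod.cong, auto)
  also have "\<dots> = (\<Prod>i\<in>{?k - 1, ?k}. strand_factor l \<beta> j t i)"
  proof (rule prod.mono_neutral_right)
    show "\<forall>i\<in>{..<m} - {?k - 1, ?k}. strand_factor l \<beta> j t i = 1"
    proof
      fix i assume "i \<in> {..<m} - {?k - 1, ?k}"
      \<comment> \<open>Arc \<open>i\<close> borders the columns \<open>i\<close> and
        \<open>Suc i\<close>; neither is the column of the crossing, so both its regions
        persist.\<close>
      then have "step \<beta> t i = i" "?k \<noteq> i" "?k \<noteq> Suc i" by (auto simp: step_def)
      then have "arc_weight l \<beta> (Suc t) (step \<beta> t i) = arc_weight l \<beta> t i"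
        by (simp add: arc_weight_def region_at_Suc)
      then show "strand_factor l \<beta> j t i = 1" by (simp add: strand_factor_def)
    qed
  qed (use k in auto)
  also have "\<dots> = strand_factor l \<beta> j t (?k - 1) * strand_factor l \<beta> j t ?k"
    using k by simp
  finally show ?thesis by simp
qed

text \<open>The product telescopes over the levels, and the closure identifies the top level with
  the bottom one.\<close>

lemma strand_factor_prod:
  assumes "braid_word m \<beta>"
  shows "(\<Prod>t<length \<beta>. strand_factor l \<beta> j t (col \<beta> t - 1) * strand_factor l \<beta> j t (col \<beta> t)) = 1"
proof -
  have nz: "level_weight l m \<beta> j t \<noteq> 0" for t by (simp add: level_weight_def)
  have "(\<Prod>t<length \<beta>. strand_factor l \<beta> j t (col \<beta> t - 1) * strand_factor l \<beta> j t (col \<beta> t))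
      = (\<Prod>t<length \<beta>. level_weight l m \<beta> j (Suc t) / level_weight l m \<beta> j t)"
    by (rule prod.cong) (use level_weight_Suc[OF assms] in auto)
  also have "\<dots> = level_weight l m \<beta> j (length \<beta>) / level_weight l m \<beta> j 0"
    by (rule prod_lessThan_telescope) (use nz in auto)
  also have "level_weight l m \<beta> j (length \<beta>) = level_weight l m \<beta> j 0"
    unfolding level_weight_def arc_weight_def component_length[OF assms] region_at_length ..
  finally show ?thesis using nz by simp
qed

section \<open>The derivatives by the parameters\<close>

text \<open>The sign of the crossing only decides which strand is the upper one; the product of the
  two factors is symmetric in the strands.\<close>

lemma crossing_potential_derivative:
  fixes w :: "region \<Rightarrow> complex"
  assumes bw: "braid_word m \<beta>" and t: "t < length \<beta>"
    and lg: "\<forall>r\<in>regions m \<beta>. log_branch (w r) (lg r)"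
    and Li: "\<forall>k<5. dilog_branch (crossing_args \<beta> t (\<lambda>_. 1) w ! k) (Li k)"
  defines "l \<equiv> \<lambda>r. lg r (w r)"
  obtains D where
    "((\<lambda>z. crossing_potential \<beta> lg Li t ((\<lambda>_. 1)(j := z)) w)
      has_field_derivative of_real pi * \<i> * D) (at 1)"
    "exp D = strand_factor l \<beta> j t (col \<beta> t - 1) * strand_factor l \<beta> j t (col \<beta> t)"
proof -
  let ?k = "col \<beta> t"
  have k: "1 \<le> ?k" "?k < m" using braid_word_col[OF bw t] by auto
  define r1 where "r1 = left_region \<beta> t"
  define r2 where "r2 = lower_region \<beta> t"
  define r3 where "r3 = right_region \<beta> t"
  define r4 where "r4 = upper_region \<beta> t"
  have "r1 \<in> regions m \<beta>" "r2 \<in> regions m \<beta>" "r3 \<in> regions m \<beta>" "r4 \<in> regions m \<beta>"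
    unfolding r1_def r2_def r3_def r4_def left_region_def lower_region_def right_region_def
      upper_region_def
    using k t by (simp_all add: region_at_in_regions)
  then have w: "w r1 = exp (l r1)" "w r2 = exp (l r2)" "w r3 = exp (l r3)" "w r4 = exp (l r4)"
    using lg unfolding log_branch_def l_def by metis+
  have lw: "lg r (w r) = l r" for r by (simp add: l_def)
  let ?co = "component \<beta> t (over_in \<beta> t)" and ?cu = "component \<beta> t (under_in \<beta> t)"
  \<comment> \<open>These cover all cases at once: \<open>j\<close> may be the component of both
    strands, of one or of neither.\<close>
  define A B :: "complex \<Rightarrow> complex"
    where "A z = (if ?co = j then z else 1)" and "B z = (if ?cu = j then z else 1)" for z
  define \<alpha> \<alpha>' :: complex
    where "\<alpha> = (if ?co = j then 1 else 0)" and "\<alpha>' = (if ?cu = j then 1 else 0)"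
  have A: "(A has_field_derivative \<alpha>) (at 1)" "A 1 = 1"
    and B: "(B has_field_derivative \<alpha>') (at 1)" "B 1 = 1"
    unfolding A_def B_def \<alpha>_def \<alpha>'_def by (auto intro!: derivative_eq_intros)
  have AB: "over_param \<beta> ((\<lambda>_. 1)(j := z)) t = A z" "under_param \<beta> ((\<lambda>_. 1)(j := z)) t = B z" for z
    by (simp_all add: over_param_def under_param_def A_def B_def)
  have AB1: "over_param \<beta> (\<lambda>_. 1) t = 1" "under_param \<beta> (\<lambda>_. 1) t = 1"
    by (simp_all add: over_param_def under_param_def)
  define s :: complex where "s = (if ?co = ?cu then if positive \<beta> t then 1 else -1 else 0)"
  have extra: "((\<lambda>z. s * (of_real pi * \<i> * A z)\<^sup>2)
      has_field_derivative of_real pi * \<i> * (s * (2 * of_real pi * \<i>) * \<alpha>)) (at 1)"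
    by (rule derivative_eq_intros A(1) refl)+ (simp add: A(2) power2_eq_square algebra_simps)
  \<comment> \<open>The extra term of a self-crossing contributes 0 or an integral multiple of
    \<open>2 * pi * \<i>\<close> at parameter 1.\<close>
  have exp_extra: "exp (s * (2 * of_real pi * \<i>) * \<alpha>) = 1"
    by (simp add: s_def \<alpha>_def exp_minus)
  \<comment> \<open>Where the weight is nonzero, the default value 1 of \<open>arc_weight\<close> is
    avoided. The left and right regions are the same just above the crossing.\<close>
  have arcs: "weight (l r1) (l r2) \<noteq> 0 \<Longrightarrow> arc_weight l \<beta> t (?k - 1) = weight (l r1) (l r2)"
    "weight (l r2) (l r3) \<noteq> 0 \<Longrightarrow> arc_weight l \<beta> t ?k = weight (l r2) (l r3)"
    "weight (l r1) (l r4) \<noteq> 0 \<Longrightarrow> arc_weight l \<beta> (Suc t) (?k - 1) = weight (l r1) (l r4)"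
    "weight (l r4) (l r3) \<noteq> 0 \<Longrightarrow> arc_weight l \<beta> (Suc t) ?k = weight (l r4) (l r3)"
    using k unfolding arc_weight_def r1_def r2_def r3_def r4_def left_region_def lower_region_def
      right_region_def upper_region_def by (simp_all add: region_at_Suc)
  have steps: "step \<beta> t (?k - 1) = ?k" "step \<beta> t ?k = ?k - 1"
    using k by (auto simp: step_def)
  have ex: "exp (\<alpha> * X) = (if ?co = j then exp X else 1)"
    "exp (\<alpha>' * X) = (if ?cu = j then exp X else 1)" for X
    by (simp_all add: \<alpha>_def \<alpha>'_def)
  show thesis
  proof (cases "positive \<beta> t")
    case True
    have "\<forall>k<5. dilog_branch (pos_args 1 1 (exp (l r1)) (exp (l r2)) (exp (l r3)) (exp (l r4)) ! k) (Li k)"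
      using Li True unfolding crossing_args_def AB1 r1_def[symmetric] r2_def[symmetric]
        r3_def[symmetric] r4_def[symmetric] w by simp
    from pos_potential_derivative[OF A B this] obtain X Y where XY:
      "((\<lambda>z. pos_potential Li (A z) (B z)
          (pos_args (A z) (B z) (exp (l r1)) (exp (l r2)) (exp (l r3)) (exp (l r4)))
          (l r1) (l r2) (l r3) (l r4))
        has_field_derivative of_real pi * \<i> * (\<alpha> * X + \<alpha>' * Y)) (at 1)"
      "exp X = weight (l r4) (l r3) / weight (l r1) (l r2)"
      "exp Y = weight (l r1) (l r4) / weight (l r2) (l r3)"
      and nz: "weight (l r4) (l r3) \<noteq> 0" "weight (l r1) (l r2) \<noteq> 0"
        "weight (l r1) (l r4) \<noteq> 0" "weight (l r2) (l r3) \<noteq> 0" .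
    have in_arcs: "over_in \<beta> t = ?k - 1" "under_in \<beta> t = ?k"
      using True by (simp_all add: over_in_def under_in_def)
    show thesis
    proof (rule that[of "\<alpha> * X + \<alpha>' * Y + s * (2 * of_real pi * \<i>) * \<alpha>"])
      have "(\<lambda>z. crossing_potential \<beta> lg Li t ((\<lambda>_. 1)(j := z)) w)
          = (\<lambda>z. pos_potential Li (A z) (B z)
            (pos_args (A z) (B z) (exp (l r1)) (exp (l r2)) (exp (l r3)) (exp (l r4)))
            (l r1) (l r2) (l r3) (l r4) + s * (of_real pi * \<i> * A z)\<^sup>2)"
        using True unfolding crossing_potential_def crossing_args_def AB Let_def
          r1_def[symmetric] r2_def[symmetric] r3_def[symmetric] r4_def[symmetric] lw
        by (simp add: s_def fun_eq_iff w)
      then show "((\<lambda>z. crossing_potential \<beta> lg Li t ((\<lambda>_. 1)(j := z)) w) has_field_derivative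
          of_real pi * \<i> * (\<alpha> * X + \<alpha>' * Y + s * (2 * of_real pi * \<i>) * \<alpha>)) (at 1)"
        using DERIV_add[OF XY(1) extra] by (simp only: distrib_left)
      show "exp (\<alpha> * X + \<alpha>' * Y + s * (2 * of_real pi * \<i>) * \<alpha>)
          = strand_factor l \<beta> j t (?k - 1) * strand_factor l \<beta> j t ?k"
        unfolding exp_add exp_extra ex XY strand_factor_def steps in_arcs arcs(1)[OF nz(2)]
          arcs(2)[OF nz(4)] arcs(3)[OF nz(3)] arcs(4)[OF nz(1)] by simp
    qed
  next
    case False
    have "\<forall>k<5. dilog_branch (neg_args 1 1 (exp (l r1)) (exp (l r2)) (exp (l r3)) (exp (l r4)) ! k) (Li k)"
      using Li False unfolding crossing_args_def AB1 r1_def[symmetric] r2_def[symmetric]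
        r3_def[symmetric] r4_def[symmetric] w by simp
    from neg_potential_derivative[OF A B this] obtain X Y where XY:
      "((\<lambda>z. neg_potential Li (A z) (B z)
          (neg_args (A z) (B z) (exp (l r1)) (exp (l r2)) (exp (l r3)) (exp (l r4)))
          (l r1) (l r2) (l r3) (l r4))
        has_field_derivative of_real pi * \<i> * (\<alpha> * X + \<alpha>' * Y)) (at 1)"
      "exp X = weight (l r1) (l r4) / weight (l r2) (l r3)"
      "exp Y = weight (l r4) (l r3) / weight (l r1) (l r2)"
      and nz: "weight (l r4) (l r3) \<noteq> 0" "weight (l r1) (l r2) \<noteq> 0"
        "weight (l r1) (l r4) \<noteq> 0" "weight (l r2) (l r3) \<noteq> 0" .
    have in_arcs: "over_in \<beta> t = ?k" "under_in \<beta> t = ?k - 1"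
      using False by (simp_all add: over_in_def under_in_def)
    show thesis
    proof (rule that[of "\<alpha> * X + \<alpha>' * Y + s * (2 * of_real pi * \<i>) * \<alpha>"])
      have "(\<lambda>z. crossing_potential \<beta> lg Li t ((\<lambda>_. 1)(j := z)) w)
          = (\<lambda>z. neg_potential Li (A z) (B z)
            (neg_args (A z) (B z) (exp (l r1)) (exp (l r2)) (exp (l r3)) (exp (l r4)))
            (l r1) (l r2) (l r3) (l r4) + s * (of_real pi * \<i> * A z)\<^sup>2)"
        using False unfolding crossing_potential_def crossing_args_def AB Let_def
          r1_def[symmetric] r2_def[symmetric] r3_def[symmetric] r4_def[symmetric] lw
        by (simp add: s_def fun_eq_iff w)
      then show "((\<lambda>z. crossing_potential \<beta> lg Li t ((\<lambda>_. 1)(j := z)) w) has_field_derivative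
          of_real pi * \<i> * (\<alpha> * X + \<alpha>' * Y + s * (2 * of_real pi * \<i>) * \<alpha>)) (at 1)"
        using DERIV_add[OF XY(1) extra] by (simp only: distrib_left)
      show "exp (\<alpha> * X + \<alpha>' * Y + s * (2 * of_real pi * \<i>) * \<alpha>)
          = strand_factor l \<beta> j t (?k - 1) * strand_factor l \<beta> j t ?k"
        unfolding exp_add exp_extra ex XY strand_factor_def steps in_arcs arcs(1)[OF nz(2)]
          arcs(2)[OF nz(4)] arcs(3)[OF nz(3)] arcs(4)[OF nz(1)] by simp
    qed
  qed
qed

text \<open>At parameter 1 these equations are identities in the region variables: the exponential
  of the sum over the crossings is the telescoping product of strand factors.\<close>

lemma potential_branch_parameter_derivative:
  assumes bw: "braid_word m \<beta>" and \<Phi>: "potential_branch m \<beta> (\<lambda>_. 1) w \<Phi>"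
  shows "exp (1 / (of_real pi * \<i>) * deriv (\<lambda>z. \<Phi> ((\<lambda>_. 1)(j := z)) w) 1) = 1"
proof -
  obtain lg Li where lg: "\<forall>r\<in>regions m \<beta>. log_branch (w r) (lg r)"
    and Li: "\<forall>t<length \<beta>. \<forall>k<5. dilog_branch (crossing_args \<beta> t (\<lambda>_. 1) w ! k) (Li t k)"
    and \<Phi>_eq: "\<Phi> = (\<lambda>a w. \<Sum>t<length \<beta>. crossing_potential \<beta> lg (Li t) t a w)"
    using \<Phi> unfolding potential_branch_def by blast
  define E where "E t = strand_factor (\<lambda>r. lg r (w r)) \<beta> j t (col \<beta> t - 1)
    * strand_factor (\<lambda>r. lg r (w r)) \<beta> j t (col \<beta> t)" for t
  have "\<forall>t\<in>{..<length \<beta>}. \<exists>D. ((\<lambda>z. crossing_potential \<beta> lg (Li t) t ((\<lambda>_. 1)(j := z)) w)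
      has_field_derivative of_real pi * \<i> * D) (at 1) \<and> exp D = E t"
  proof
    fix t assume "t \<in> {..<length \<beta>}"
    then have t: "t < length \<beta>" by simp
    show "\<exists>D. ((\<lambda>z. crossing_potential \<beta> lg (Li t) t ((\<lambda>_. 1)(j := z)) w)
        has_field_derivative of_real pi * \<i> * D) (at 1) \<and> exp D = E t"
      unfolding E_def
      using crossing_potential_derivative[OF bw t lg Li[THEN spec, THEN mp, OF t], of j] by blast
  qed
  \<comment> \<open>One logarithm of the factor \<open>E t\<close> is chosen per crossing.\<close>
  then obtain D where D: "\<forall>t\<in>{..<length \<beta>}.
      ((\<lambda>z. crossing_potential \<beta> lg (Li t) t ((\<lambda>_. 1)(j := z)) w)
        has_field_derivative of_real pi * \<i> * D t) (at 1) \<and> exp (D t) = E t"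
    by metis
  have "((\<lambda>z. \<Phi> ((\<lambda>_. 1)(j := z)) w) has_field_derivative
      (\<Sum>t<length \<beta>. of_real pi * \<i> * D t)) (at 1)"
    unfolding \<Phi>_eq using D by (intro DERIV_sum) auto
  then have "deriv (\<lambda>z. \<Phi> ((\<lambda>_. 1)(j := z)) w) 1 = of_real pi * \<i> * (\<Sum>t<length \<beta>. D t)"
    by (simp add: DERIV_imp_deriv sum_distrib_left)
  then have "exp (1 / (of_real pi * \<i>) * deriv (\<lambda>z. \<Phi> ((\<lambda>_. 1)(j := z)) w) 1)
      = (\<Prod>t<length \<beta>. exp (D t))"
    by (simp add: exp_sum)
  also have "\<dots> = (\<Prod>t<length \<beta>. E t)"
    using D by (intro prod.cong) auto
  also have "\<dots> = 1"
    unfolding E_def by (rule strand_factor_prod[OF bw])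
  finally show ?thesis .
qed

theorem theorem5p3:
  fixes m :: nat and \<beta> :: braid and \<epsilon> :: real
    and \<sigma> :: "(nat \<Rightarrow> real) \<Rightarrow> region \<Rightarrow> complex"
    and U :: "(complex \<times> real) set"
    and p :: "complex \<times> real \<Rightarrow> (complex \<times> real) \<times> real"
    and dev :: "(nat \<Rightarrow> real) \<Rightarrow> complex \<times> real \<Rightarrow> complex \<times> real"
    and V :: "(nat \<Rightarrow> real) \<Rightarrow> complex \<times> real \<Rightarrow> complex^2"
  assumes "braid_word m \<beta>"
    and "hyperbolic_link m \<beta>"
    and "0 < \<epsilon>"
    and "\<And>a. (\<forall>j\<in>link_components m \<beta>. a j \<in> {1 - \<epsilon>..1}) \<Longrightarrow>
           w_saddle_point m \<beta> (\<lambda>j. of_real (a j)) (\<sigma> a) \<and>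
           gives_structure m \<beta> (\<lambda>j. of_real (a j)) (\<sigma> a) U p (dev a) (V a)"
    and "finite_volume_structure (link_complement m \<beta>) U p (dev (\<lambda>_. 1))"
  shows "saddle_point m \<beta> (\<lambda>_. 1) (\<sigma> (\<lambda>_. 1)) \<and>
         gives_structure m \<beta> (\<lambda>_. 1) (\<sigma> (\<lambda>_. 1)) U p (dev (\<lambda>_. 1)) (V (\<lambda>_. 1)) \<and>
         complete_structure U (dev (\<lambda>_. 1))"
proof -
  \<comment> \<open>The constant family 1 lies in the allowed range of parameters, as \<epsilon> is
    positive.\<close>
  have w: "w_saddle_point m \<beta> (\<lambda>_. 1) (\<sigma> (\<lambda>_. 1))"
    and g: "gives_structure m \<beta> (\<lambda>_. 1) (\<sigma> (\<lambda>_. 1)) U p (dev (\<lambda>_. 1)) (V (\<lambda>_. 1))"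
    using assms(4)[of "\<lambda>_. 1"] assms(3) by simp_all
  have "saddle_point m \<beta> (\<lambda>_. 1) (\<sigma> (\<lambda>_. 1))"
    using w potential_branch_parameter_derivative[OF assms(1)]
    unfolding saddle_point_def w_saddle_point_def by blast
  moreover have "hyperbolic_structure (link_complement m \<beta>) U p (dev (\<lambda>_. 1))"
    using g unfolding gives_structure_def by blast
  then have "complete_structure U (dev (\<lambda>_. 1))"
    using finite_volume_imp_complete assms(5) by blast
  ultimately show ?thesis using g by blast
qed

end
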